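(* Let $\textbf{G}$ be a state tree structure over $\Sigma=\Sigma_c\,\dot\cup\,\Sigma_u$ whose plant agents may share events, and let $P$ be a predicate of illegal basic trees with $\sup\mathcal{NC}(\neg P)\wedge P_0\neq false$. Let $\textbf{SUP}=(\textbf{G}^f,\{f_\sigma\mid\sigma\in\Sigma_c\})$ be the monolithic optimal nonblocking supervisor, with state set $B_S$. For each controllable event $\sigma\in\Sigma_c$ let $\mathcal{C}_\sigma=\{B_{\sigma,i}\subseteq B_S\mid i\in I_\sigma\}$ be a control cover on $B_S$ with respect to $\sigma$, let $\textbf{G}^f_\sigma=(I_\sigma,\Sigma_{l,\sigma},\delta_\sigma,i_{0,\sigma},I_{m,\sigma})$ be a local state tracker constructed from $\mathcal{C}_\sigma$, and let $g_\sigma:I_\sigma\to\{0,1\}$ be the corresponding local control function. Then $\textbf{LOC}=\{(\textbf{G}^f_\sigma,g_\sigma)\mid\sigma\in\Sigma_c\}$ is control equivalent to $\textbf{SUP}$; namely, for every $\sigma\in\Sigma_c$ and every $b\in B_S$ there exists $i\in I_\sigma$ such that $b\in B_{\sigma,i}$ and (i) if $\Delta(b,\sigma)\neq\emptyset$, then $f_\sigma(b)=1$ if and only if $g_\sigma(i)=1$; (ii) $b\models P_m^f$ if and only if $b\models P_m$ and $i\in I_{m,\sigma}$.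
   Context: **State tree structures.** A state tree structure $\textbf{G}=(\textbf{S}T,\mathcal{H},\Sigma,\Delta,P_0,P_m)$ enters the claim only through the following data: the finite set $\mathcal{B}(\textbf{S}T)$ of basic trees (the "flat" system states); the finite event set $\Sigma=\Sigma_c\,\dot\cup\,\Sigma_u$ (controllable / uncontrollable events); the transition function $\Delta$, where for a basic tree $b$ and event $\sigma$, $\Delta(b,\sigma)$ is either $\emptyset$ ($\sigma$ not defined at $b$) or a single basic tree (identified with the corresponding one-element set when used as a set); and the initial and marker predicates $P_0,P_m$. A predicate is a function $Q:\mathcal{B}(\textbf{S}T)\to\{0,1\}$; $b\models Q$ means $Q(b)=1$; $Q\preceq Q'$ means $b\models Q\Rightarrow b\models Q'$ for all $b$; $\neg,\wedge,\vee$ are pointwise; $true$, $false$ are the constant predicates. $\textbf{G}$ models a plant composed of $n$ agents (whose alphabets need not be disjoint) together with a specification over $\Sigma$. The predicate $P$ describes the illegal basic trees. **Monolithic supervisor.** $R(\textbf{G},Q)$ holds exactly on basic trees reachable in $\textbf{G}$ from some $b_0\models Q\wedge P_0$ by a path of basic trees all satisfying $Q$; $CR(\textbf{G},Q)$ holds exactly on basic trees from which some $b_m\models Q\wedge P_m$ can be reached by a path of basic trees all satisfying $Q$. $Q$ is nonblocking if $R(\textbf{G},Q)\preceq CR(\textbf{G},Q)$. $Q$ is weakly controllable if for all $\sigma\in\Sigma_u$ and $b\models Q$, either $\Delta(b,\sigma)=\emptyset$ or $\Delta(b,\sigma)\models Q$. $\sup\mathcal{NC}(\neg P)$ is the largest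 nonblocking and weakly controllable predicate $K\preceq\neg P$ (it exists). Put $S:=R(\textbf{G},\sup\mathcal{NC}(\neg P))$ and $B_S:=\{b\mid b\models S\}$. For $\sigma\in\Sigma$: $f_\sigma(b)=1$ if $\Delta(b,\sigma)=\emptyset$ or ($\Delta(b,\sigma)\neq\emptyset$ and $\Delta(b,\sigma)\models S$); $f_\sigma(b)=0$ if $\Delta(b,\sigma)\neq\emptyset$ and $\Delta(b,\sigma)\models\neg S$. The closed-loop transition function is $\Delta^f(b,\sigma)=\Delta(b,\sigma)$ if $f_\sigma(b)=1$ and $\emptyset$ otherwise. The set of basic trees reachable in the closed-loop system $\textbf{G}^f$ is $B_S$, i.e. $R(\textbf{G}^f,true)=S$, and $P_m^f:=S\wedge P_m$, $P_0^f:=S\wedge P_0$. **Control consistency and control covers with respect to an event.** $\Gamma(Q,\sigma)$ holds on $b$ iff $\Delta(b,\sigma)\neq\emptyset$ and $\Delta(b,\sigma)\models Q$. $Next_{\textbf{G}}(\sigma)$ holds on the basic trees that are reached by a one-step transition $\sigma$ from some basic tree. $N_{good}(\sigma):=Next_{\textbf{G}}(\sigma)\wedge S$, $N_{bad}(\sigma):=Next_{\textbf{G}}(\sigma)\wedge\neg S$. On $B_S$ define $E_\sigma:=\Gamma(N_{good}(\sigma),\sigma)\wedge S$, $D_\sigma:=\Gamma(N_{bad}(\sigma),\sigma)\wedge S$, $M(b)=1$ iff $b\models P_m^f$, $T(b)=1$ iff $b\models P_m$. For $\sigma\in\Sigma_c$ the control consistency relation $\mathcal{R}_\sigma\subseteq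 B_S\times B_S$ is: $(b,b')\in\mathcal{R}_\sigma$ iff (1) $E_\sigma(b)\wedge D_\sigma(b')=false=E_\sigma(b')\wedge D_\sigma(b)$; and (2) $T(b)=T(b')\Rightarrow M(b)=M(b')$. A cover $\mathcal{C}_\sigma=\{B_{\sigma,i}\subseteq B_S\mid i\in I_\sigma\}$ of $B_S$ (nonempty cells with union $B_S$, possibly overlapping) is a control cover with respect to $\sigma$ if (1) for all $i\in I_\sigma$ and $b,b'\in B_{\sigma,i}$, $(b,b')\in\mathcal{R}_\sigma$; and (2) for all $i\in I_\sigma$, $\sigma'\in\Sigma$: if some $b\in B_{\sigma,i}$ has $\Delta^f(b,\sigma')\neq\emptyset$, then there is $j\in I_\sigma$ such that $\Delta^f(b',\sigma')\subseteq B_{\sigma,j}$ for all $b'\in B_{\sigma,i}$. **Local state tracker and local control function.** Given $\mathcal{C}_\sigma$, the tracker $\textbf{G}^f_\sigma$ has state set $I_\sigma$, initial state $i_{0,\sigma}$ the index of a cell containing the initial basic tree, and marker states $I_{m,\sigma}:=\{i\in I_\sigma\mid B_{\sigma,i}\cap\{b\in B_S\mid b\models P_m^f\}\neq\emptyset\}$. Its transitions follow cells: from $i$ on $\sigma'$ to (a chosen) $j$ if some $b\in B_{\sigma,i}$ has $\Delta^f(b,\sigma')\neq\emptyset$ and $\Delta^f(b',\sigma')\subseteq B_{\sigma,j}$ for all $b'\in B_{\sigma,i}$, restricted to a local event set $\Sigma_{l,\sigma}\subseteq\Sigma$; the transition structure does not enter conditions (i), (ii). The local control function is $g_\sigma(i)=1$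 iff there exists $b\in B_{\sigma,i}$ with $b\models\Gamma(N_{good}(\sigma),\sigma)$. *)

theory Defs
  imports Main
begin

type_synonym 'b predicate = "'b \<Rightarrow> bool"

text \<open>
  The flat data of a state tree structure. The finite set of basic trees is the type \<open>'b\<close>, so that
  the order and the Boolean operations on predicates are those of the function space
  \<open>'b \<Rightarrow> bool\<close>. \<open>delta G b s = None\<close> encodes that \<open>s\<close> is not defined at \<open>b\<close> (the value is the empty
  set); \<open>set_option\<close> recovers the set-valued reading. \<open>ctrl\<close> and \<open>unctrl\<close> are the controllable and
  the uncontrollable events. Nothing is assumed about how the events are distributed over the
  component agents, so agents may share events.
\<close>

record ('b, 'e) sts =
  ctrl :: "'e set"
  unctrl :: "'e set"
  delta :: "'b \<Rightarrow> 'e \<Rightarrow> 'b option"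
  P_init :: "'b predicate"
  P_mark :: "'b predicate"

definition events :: "('b, 'e, 'z) sts_scheme \<Rightarrow> 'e set" where
  "events G = ctrl G \<union> unctrl G"

definition state_tree_structure :: "('b::finite, 'e) sts \<Rightarrow> bool" where
  "state_tree_structure G \<longleftrightarrow>
     finite (events G) \<and> ctrl G \<inter> unctrl G = {} \<and>
     (\<forall>b s. s \<notin> events G \<longrightarrow> delta G b s = None)"


inductive reach :: "('b, 'e) sts \<Rightarrow> 'b predicate \<Rightarrow> 'b predicate"
  for G :: "('b, 'e) sts" and Q :: "'b predicate" where
  start: "Q b \<Longrightarrow> P_init G b \<Longrightarrow> reach G Q b"
| step: "reach G Q b \<Longrightarrow> s \<in> events G \<Longrightarrow> delta G b s = Some b' \<Longrightarrow> Q b' \<Longrightarrow> reach G Q b'"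

inductive coreach :: "('b, 'e) sts \<Rightarrow> 'b predicate \<Rightarrow> 'b predicate"
  for G :: "('b, 'e) sts" and Q :: "'b predicate" where
  marked: "Q b \<Longrightarrow> P_mark G b \<Longrightarrow> coreach G Q b"
| step: "Q b \<Longrightarrow> s \<in> events G \<Longrightarrow> delta G b s = Some b' \<Longrightarrow> coreach G Q b' \<Longrightarrow> coreach G Q b"

definition nonblocking :: "('b, 'e) sts \<Rightarrow> 'b predicate \<Rightarrow> bool" where
  "nonblocking G Q \<longleftrightarrow> reach G Q \<le> coreach G Q"

text \<open>\<open>pred_option Q x\<close> holds for \<open>x = None\<close>; whenever this matters below, \<open>x \<noteq> None\<close> is required
  explicitly.\<close>

definition weakly_controllable :: "('b, 'e) sts \<Rightarrow> 'b predicate \<Rightarrow> bool" where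
  "weakly_controllable G Q \<longleftrightarrow>
     (\<forall>s\<in>unctrl G. \<forall>b. Q b \<longrightarrow> delta G b s = None \<or> pred_option Q (delta G b s))"

definition NC :: "('b, 'e) sts \<Rightarrow> 'b predicate \<Rightarrow> 'b predicate set" where
  "NC G Q = {K. nonblocking G K \<and> weakly_controllable G K \<and> K \<le> Q}"

text \<open>\<open>GREATEST\<close> denotes the largest element if there is one and is unspecified otherwise.\<close>

definition sup_NC :: "('b, 'e) sts \<Rightarrow> 'b predicate \<Rightarrow> 'b predicate" where
  "sup_NC G Q = (GREATEST K. K \<in> NC G Q)"

lemma sup_NC_eqI:
  assumes "K \<in> NC G Q" and "\<And>K'. K' \<in> NC G Q \<Longrightarrow> K' \<le> K"
  shows "sup_NC G Q = K"
  unfolding sup_NC_def using assms by (rule Greatest_equality)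


text \<open>In the following, \<open>P\<close> is the predicate of the illegal basic trees.\<close>

definition sup_pred :: "('b, 'e) sts \<Rightarrow> 'b predicate \<Rightarrow> 'b predicate" where
  "sup_pred G P = reach G (sup_NC G (- P))"

definition B_S :: "('b, 'e) sts \<Rightarrow> 'b predicate \<Rightarrow> 'b set" where
  "B_S G P = {b. sup_pred G P b}"

definition sup_ctrl :: "('b, 'e) sts \<Rightarrow> 'b predicate \<Rightarrow> 'e \<Rightarrow> 'b \<Rightarrow> bool" where
  "sup_ctrl G P s b \<longleftrightarrow>
     delta G b s = None \<or> (delta G b s \<noteq> None \<and> pred_option (sup_pred G P) (delta G b s))"

definition closed_loop :: "('b, 'e) sts \<Rightarrow> 'b predicate \<Rightarrow> ('b, 'e) sts" where
  "closed_loop G P = G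
     \<lparr>delta := (\<lambda>b s. if sup_ctrl G P s b then delta G b s else None),
      P_init := inf (sup_pred G P) (P_init G),
      P_mark := inf (sup_pred G P) (P_mark G)\<rparr>"

lemma reach_closed_loop: "reach (closed_loop G P) top = sup_pred G P"
proof (intro ext iffI)
  fix b assume "reach (closed_loop G P) top b"
  then show "sup_pred G P b"
    by induction (auto simp: closed_loop_def sup_ctrl_def split: if_splits)
next
  fix b assume "sup_pred G P b"
  then have "reach G (sup_NC G (- P)) b" by (simp add: sup_pred_def)
  then show "reach (closed_loop G P) top b"
  proof induction
    case (start b)
    then show ?case
      by (intro reach.start) (auto simp: closed_loop_def sup_pred_def intro: reach.start)
  next
    case (step b s b')
    then have "sup_pred G P b'" unfolding sup_pred_def by (blast intro: reach.step)
    with step show ?case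
      by (intro reach.step[of _ _ b s b']) (auto simp: closed_loop_def sup_ctrl_def events_def)
  qed
qed


definition enabled_into :: "('b, 'e) sts \<Rightarrow> 'b predicate \<Rightarrow> 'e \<Rightarrow> 'b predicate" where
  \<comment> \<open>\<open>\<Gamma>(Q, s)\<close>\<close>
  "enabled_into G Q s b \<longleftrightarrow> delta G b s \<noteq> None \<and> pred_option Q (delta G b s)"

definition Next :: "('b, 'e) sts \<Rightarrow> 'e \<Rightarrow> 'b predicate" where
  "Next G s b \<longleftrightarrow> (\<exists>b'. delta G b' s = Some b)"

definition N_good :: "('b, 'e) sts \<Rightarrow> 'b predicate \<Rightarrow> 'e \<Rightarrow> 'b predicate" where
  "N_good G P s = inf (Next G s) (sup_pred G P)"

definition N_bad :: "('b, 'e) sts \<Rightarrow> 'b predicate \<Rightarrow> 'e \<Rightarrow> 'b predicate" where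
  "N_bad G P s = inf (Next G s) (- sup_pred G P)"

definition E_pred :: "('b, 'e) sts \<Rightarrow> 'b predicate \<Rightarrow> 'e \<Rightarrow> 'b predicate" where
  "E_pred G P s = inf (enabled_into G (N_good G P s) s) (sup_pred G P)"

definition D_pred :: "('b, 'e) sts \<Rightarrow> 'b predicate \<Rightarrow> 'e \<Rightarrow> 'b predicate" where
  "D_pred G P s = inf (enabled_into G (N_bad G P s) s) (sup_pred G P)"

text \<open>In the last conjunct, \<open>P_mark G\<close> is \<open>T\<close> and \<open>P_mark (closed_loop G P)\<close> is \<open>M\<close>.\<close>

definition control_consistent :: "('b, 'e) sts \<Rightarrow> 'b predicate \<Rightarrow> 'e \<Rightarrow> ('b \<times> 'b) set" where
  "control_consistent G P s =
     {(b, b'). b \<in> B_S G P \<and> b' \<in> B_S G P \<and>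
        (E_pred G P s b \<and> D_pred G P s b') = False \<and>
        (E_pred G P s b' \<and> D_pred G P s b) = False \<and>
        (P_mark G b = P_mark G b' \<longrightarrow>
           P_mark (closed_loop G P) b = P_mark (closed_loop G P) b')}"

definition control_cover ::
  "('b, 'e) sts \<Rightarrow> 'b predicate \<Rightarrow> 'e \<Rightarrow> 'i set \<Rightarrow> ('i \<Rightarrow> 'b set) \<Rightarrow> bool" where
  "control_cover G P s I C \<longleftrightarrow>
     (\<forall>i\<in>I. C i \<noteq> {} \<and> C i \<subseteq> B_S G P) \<and> (\<Union>i\<in>I. C i) = B_S G P \<and>
     (\<forall>i\<in>I. \<forall>b\<in>C i. \<forall>b'\<in>C i. (b, b') \<in> control_consistent G P s) \<and>
     (\<forall>i\<in>I. \<forall>s'\<in>events G.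
        (\<exists>b\<in>C i. delta (closed_loop G P) b s' \<noteq> None) \<longrightarrow>
        (\<exists>j\<in>I. \<forall>b'\<in>C i. set_option (delta (closed_loop G P) b' s') \<subseteq> C j))"


record ('i, 'e) tracker =
  states :: "'i set"
  local_events :: "'e set"
  move :: "'i \<Rightarrow> 'e \<Rightarrow> 'i option"
  init :: "'i"
  markers :: "'i set"

definition cell_step ::
  "('b, 'e) sts \<Rightarrow> 'b predicate \<Rightarrow> 'i set \<Rightarrow> ('i \<Rightarrow> 'b set) \<Rightarrow> 'i \<Rightarrow> 'e \<Rightarrow> 'i \<Rightarrow> bool" where
  "cell_step G P I C i s' j \<longleftrightarrow>
     j \<in> I \<and> (\<exists>b\<in>C i. delta (closed_loop G P) b s' \<noteq> None) \<and>
     (\<forall>b'\<in>C i. set_option (delta (closed_loop G P) b' s') \<subseteq> C j)"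

text \<open>
  Since cells may overlap, the initial state and the targets of transitions are not determined by
  the cover; the tracker is any automaton resulting from some choice. If several basic trees satisfy
  the initial predicate, the initial cell is only required to contain one of them.
\<close>

definition local_state_tracker ::
  "('b, 'e) sts \<Rightarrow> 'b predicate \<Rightarrow> 'i set \<Rightarrow> ('i \<Rightarrow> 'b set) \<Rightarrow> ('i, 'e) tracker \<Rightarrow> bool" where
  "local_state_tracker G P I C A \<longleftrightarrow>
     states A = I \<and>
     local_events A \<subseteq> events G \<and>
     (\<forall>i\<in>I. \<forall>s'\<in>local_events A. case move A i s' of
        None \<Rightarrow> \<nexists>j. cell_step G P I C i s' j
      | Some j \<Rightarrow> cell_step G P I C i s' j) \<and>
     (\<forall>i\<in>I. \<forall>s'. s' \<notin> local_events A \<longrightarrow> move A i s' = None) \<and>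
     init A \<in> I \<and> (\<exists>b\<in>C (init A). P_init (closed_loop G P) b) \<and>
     markers A = {i\<in>I. C i \<inter> {b \<in> B_S G P. P_mark (closed_loop G P) b} \<noteq> {}}"

definition local_ctrl ::
  "('b, 'e) sts \<Rightarrow> 'b predicate \<Rightarrow> 'e \<Rightarrow> ('i \<Rightarrow> 'b set) \<Rightarrow> 'i \<Rightarrow> bool" where
  "local_ctrl G P s C i \<longleftrightarrow> (\<exists>b\<in>C i. enabled_into G (N_good G P s) s b)"

end

theory Submission
  imports Defs
begin

text \<open>
  Any cell containing \<open>b\<close> can serve as the witness. If \<open>\<sigma>\<close> leads from \<open>b\<close> to an illegal tree, then \<open>D\<^sub>\<sigma>\<close> holds at \<open>b\<close>,
  and consistency with \<open>b\<close> excludes \<open>E\<^sub>\<sigma>\<close> in the whole cell. The marking condition is immediate,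
  since \<open>M\<close> and \<open>T\<close> agree on \<open>B_S\<close>.
\<close>

text \<open>The conjunct \<open>Next G s\<close> is automatic for a tree just reached by
  \<open>s\<close>, so \<open>E_pred\<close> and \<open>D_pred\<close> differ only in whether that
  successor stays in \<open>B_S\<close>.\<close>

lemma E_pred_iff: "E_pred G P s b \<longleftrightarrow> b \<in> B_S G P \<and> (\<exists>b'\<in>B_S G P. delta G b s = Some b')"
  by (auto simp: E_pred_def enabled_into_def N_good_def Next_def B_S_def)

lemma D_pred_iff: "D_pred G P s b \<longleftrightarrow> b \<in> B_S G P \<and> (\<exists>b'. b' \<notin> B_S G P \<and> delta G b s = Some b')"
  by (auto simp: D_pred_def enabled_into_def N_bad_def Next_def B_S_def)

text \<open>\<open>E_pred\<close> additionally demands \<open>sup_pred G P\<close>, which comes for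
  free inside a cell contained in \<open>B_S\<close>.\<close>

lemma local_ctrl_iff:
  assumes "C i \<subseteq> B_S G P"
  shows "local_ctrl G P s C i \<longleftrightarrow> (\<exists>b\<in>C i. E_pred G P s b)"
  using assms by (auto simp: local_ctrl_def E_pred_def B_S_def)

lemma sup_ctrl_iff_local_ctrl:
  assumes cover: "control_cover G P s I C" and i: "i \<in> I" and b: "b \<in> C i"
    and enabled: "delta G b s \<noteq> None"
  shows "sup_ctrl G P s b \<longleftrightarrow> local_ctrl G P s C i"
proof -
  have cell: "C i \<subseteq> B_S G P" and
    consistent: "\<And>b'. b' \<in> C i \<Longrightarrow> (b', b) \<in> control_consistent G P s"
    using cover i b by (auto simp: control_cover_def)
  have E: "sup_ctrl G P s b \<longleftrightarrow> E_pred G P s b"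
    using enabled b cell by (auto simp: sup_ctrl_def E_pred_iff B_S_def)
  \<comment> \<open>The dichotomy needs \<open>s\<close> to be defined at \<open>b\<close>.
    Consistency of \<open>b'\<close> with \<open>b\<close> then rules out the second alternative as
    soon as \<open>E_pred\<close> holds at \<open>b'\<close>.\<close>
  have "E_pred G P s b \<or> D_pred G P s b"
    using enabled b cell by (auto simp: E_pred_iff D_pred_iff)
  then have "E_pred G P s b" if "b' \<in> C i" "E_pred G P s b'" for b'
    using consistent[OF that(1)] that(2) by (auto simp: control_consistent_def)
  then show ?thesis
    using E b by (auto simp: local_ctrl_iff[where C = C and i = i, OF cell])
qed

lemma P_mark_closed_loop: "P_mark (closed_loop G P) b \<longleftrightarrow> b \<in> B_S G P \<and> P_mark G b"
  by (simp add: closed_loop_def B_S_def)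

theorem proposition1:
  fixes G :: "('b::finite, 'e) sts"
    and P :: "'b predicate"
    and I :: "'e \<Rightarrow> 'i set"
    and C :: "'e \<Rightarrow> 'i \<Rightarrow> 'b set"
    and A :: "'e \<Rightarrow> ('i, 'e) tracker"
    and g :: "'e \<Rightarrow> 'i \<Rightarrow> bool"
  assumes "state_tree_structure G"
    and "inf (sup_NC G (- P)) (P_init G) \<noteq> bot"
    and "\<And>s. s \<in> ctrl G \<Longrightarrow> control_cover G P s (I s) (C s)"
    and "\<And>s. s \<in> ctrl G \<Longrightarrow> local_state_tracker G P (I s) (C s) (A s)"
    and "\<And>s i. s \<in> ctrl G \<Longrightarrow> i \<in> I s \<Longrightarrow> g s i = local_ctrl G P s (C s) i"
  shows "\<forall>s\<in>ctrl G. \<forall>b\<in>B_S G P. \<exists>i\<in>I s. b \<in> C s i \<and>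
     (delta G b s \<noteq> None \<longrightarrow> (sup_ctrl G P s b \<longleftrightarrow> g s i)) \<and>
     (P_mark (closed_loop G P) b \<longleftrightarrow> P_mark G b \<and> i \<in> markers (A s))"
proof (intro ballI)
  fix s b
  assume s: "s \<in> ctrl G" and b: "b \<in> B_S G P"
  obtain i where i: "i \<in> I s" "b \<in> C s i"
    using assms(3)[OF s] b unfolding control_cover_def by blast
  have "sup_ctrl G P s b \<longleftrightarrow> g s i" if "delta G b s \<noteq> None"
    using sup_ctrl_iff_local_ctrl[OF assms(3)[OF s] i that] assms(5)[OF s i(1)] by simp
  \<comment> \<open>If \<open>b\<close> is marked in \<open>G\<close>, then \<open>b\<close> itself
    witnesses that its cell meets the marked trees of the closed loop, so \<open>i\<close> is a
    marker state.\<close>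
  moreover have "P_mark (closed_loop G P) b \<longleftrightarrow> P_mark G b \<and> i \<in> markers (A s)"
    using assms(4)[OF s] b i by (auto simp: local_state_tracker_def P_mark_closed_loop)
  ultimately show "\<exists>i\<in>I s. b \<in> C s i \<and>
     (delta G b s \<noteq> None \<longrightarrow> (sup_ctrl G P s b \<longleftrightarrow> g s i)) \<and>
     (P_mark (closed_loop G P) b \<longleftrightarrow> P_mark G b \<and> i \<in> markers (A s))"
    using i by blast
qed

end
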